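(* Let $\bm B\in\mathbb{R}^{N_v\times 3}$ have orthonormal columns, let $a_2\geqslant 0$, $\eta>0$, and let $\bm M\in\mathbb{R}^{N_x\times N_v}$. Let $g:\mathbb{R}^{N_x\times N_v}\to\mathbb{R}\cup\{+\infty\}$ be defined by $$g(\bm X)=\|\bm X\|_{\ast}^2+\frac{a_2}{2}\|\bm X\|_F^2+I_{\{\bm X\,:\,\bm X\bm B=\bm 0\}}(\bm X).$$ Let $\bm Y$ be the minimizer $$\bm Y=\arg\min_{\bm Y\in\mathbb{R}^{N_x\times N_v}}\; g(\bm Y)+\frac{\eta}{2}\|\bm Y-\bm M\|_F^2,$$ and suppose the compact SVD of $\bm Y$ is $\bm Y=\bm U\bm\Sigma\bm V^T$. Then $\bm Y$ satisfies the implicit equation $$\bm Y=D_{\frac{2\|\bm Y\|_{\ast}}{a_2+\eta}}\left(\frac{\eta}{a_2+\eta}\,\bm M\,\bm\Pi_{\bm B}^{\perp}\right).$$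
   Context: $\|\cdot\|_F$ is the Frobenius norm and $\|\bm X\|_\ast$ is the nuclear norm (the sum of the singular values of $\bm X$). For a convex set $\mathcal C$, $I_{\mathcal C}(\bm X)=0$ if $\bm X\in\mathcal C$ and $+\infty$ otherwise. $\bm\Pi_{\bm B}^{\perp}=\bm I-\bm B\bm B^T\in\mathbb{R}^{N_v\times N_v}$. For $\tau\geqslant 0$, $D_\tau$ is the singular value soft thresholding operator: if $\bm Z=\sum_k\sigma_k\bm u_k\bm v_k^T$ is an SVD of $\bm Z$, then $D_\tau(\bm Z)=\sum_k\max\{\sigma_k-\tau,0\}\,\bm u_k\bm v_k^T$, i.e. $\tau$ is subtracted from each singular value and the non-positive ones are discarded. *)

theory Defs
  imports "HOL-Analysis.Analysis"
begin

definition frobenius_norm :: "real^'n^'m \<Rightarrow> real" where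
  "frobenius_norm X = sqrt (\<Sum>i\<in>UNIV. \<Sum>j\<in>UNIV. (X $ i $ j)\<^sup>2)"

lemma frobenius_norm_eq_norm: "frobenius_norm X = norm X"
  by (simp add: frobenius_norm_def norm_vec_def L2_set_def sum_nonneg)

definition outer_product :: "real^'m \<Rightarrow> real^'n \<Rightarrow> real^'n^'m" where
  "outer_product u v = (\<chi> i j. u $ i * v $ j)"

definition orthonormal_family :: "nat \<Rightarrow> (nat \<Rightarrow> real^'n) \<Rightarrow> bool" where
  "orthonormal_family r u \<longleftrightarrow> (\<forall>k<r. \<forall>l<r. u k \<bullet> u l = (if k = l then 1 else 0))"

text \<open>
  The number of terms of a singular value decomposition depends on the matrix and may be 0,
  so the singular vectors (the columns of U and V) are families indexed by the naturals
  below r rather than by a type. Vanishing singular values are allowed, which covers full,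
  thin and compact decompositions alike; no ordering of the singular values is required.
\<close>

definition is_svd :: "real^'n^'m \<Rightarrow> nat \<Rightarrow> (nat \<Rightarrow> real^'m) \<Rightarrow> (nat \<Rightarrow> real) \<Rightarrow> (nat \<Rightarrow> real^'n) \<Rightarrow> bool"
  where
  "is_svd Z r U \<sigma> V \<longleftrightarrow>
     orthonormal_family r U \<and> orthonormal_family r V \<and> (\<forall>k<r. 0 \<le> \<sigma> k) \<and>
     Z = (\<Sum>k<r. \<sigma> k *\<^sub>R outer_product (U k) (V k))"

definition is_compact_svd ::
    "real^'n^'m \<Rightarrow> nat \<Rightarrow> (nat \<Rightarrow> real^'m) \<Rightarrow> (nat \<Rightarrow> real) \<Rightarrow> (nat \<Rightarrow> real^'n) \<Rightarrow> bool" where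
  "is_compact_svd Z r U \<sigma> V \<longleftrightarrow> is_svd Z r U \<sigma> V \<and> (\<forall>k<r. 0 < \<sigma> k)"

text \<open>
  Every real matrix has a singular value decomposition, and neither the sum of its singular
  values nor, for nonnegative thresholds, the result of soft thresholding depends on the
  decomposition chosen; hence the definite descriptions below are meaningful.
\<close>

definition nuclear_norm :: "real^'n^'m \<Rightarrow> real" where
  "nuclear_norm Z = (THE s. \<exists>r U \<sigma> V. is_svd Z r U \<sigma> V \<and> s = (\<Sum>k<r. \<sigma> k))"

definition sv_soft_threshold :: "real \<Rightarrow> real^'n^'m \<Rightarrow> real^'n^'m" where
  "sv_soft_threshold \<tau> Z =
     (THE W. \<exists>r U \<sigma> V. is_svd Z r U \<sigma> V \<and>
        W = (\<Sum>k<r. max (\<sigma> k - \<tau>) 0 *\<^sub>R outer_product (U k) (V k)))"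

definition convex_indicator :: "'a set \<Rightarrow> 'a \<Rightarrow> ereal" where
  "convex_indicator C X = (if X \<in> C then 0 else \<infinity>)"

definition orthonormal_columns :: "real^'k^'n \<Rightarrow> bool" where
  "orthonormal_columns B \<longleftrightarrow> (\<forall>i j. column i B \<bullet> column j B = (if i = j then 1 else 0))"

definition perp_projection :: "real^'k^'n \<Rightarrow> real^'n^'n" where
  "perp_projection B = mat 1 - B ** transpose B"

end

theory Submission
  imports Defs
begin

text \<open>
  Write \<open>c = a\<^sub>2 + \<eta>\<close>, \<open>\<tau> = 2 * nuclear_norm Y / c\<close>, let \<open>Z\<close> be the matrix that is thresholded,
  \<open>W\<close> the result of thresholding it at \<open>\<tau>\<close>, and let \<open>\<bullet>\<close> be the Frobenius inner product.
  The squared nuclear norm has slope \<open>2 * nuclear_norm Y = c * \<tau>\<close> in terms of the nuclear norm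
  at \<open>Y\<close>. So, to first order at \<open>Y\<close>, the problem is the proximal problem of \<open>\<tau>\<close> times the
  nuclear norm at \<open>Z\<close>, whose solution is \<open>W\<close>.

  Two inequalities make this precise. First,
  \<open>W\<close> satisfies the constraint (\<open>mult_vec_soft_threshold_eq_0\<close>), so minimality of \<open>Y\<close> may be
  tested along the segment from \<open>Y\<close> to \<open>W\<close>. Convexity of the nuclear norm
  (\<open>minimizer_first_order_condition\<close>) and the fact that the constraint only sees the projection
  of \<open>M\<close> (\<open>inner_perp_projection\<close>) yield
  \<open>\<tau> * (nuclear_norm Y - nuclear_norm W) \<le> (Y - Z) \<bullet> (W - Y)\<close>. Second, \<open>Z - W\<close> is a
  subgradient of \<open>\<tau>\<close> times the nuclear norm at \<open>W\<close> (\<open>soft_threshold_subgradient\<close>), so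
  \<open>(Z - W) \<bullet> (Y - W) \<le> \<tau> * (nuclear_norm Y - nuclear_norm W)\<close>. Chaining the two gives
  \<open>(Y - W) \<bullet> (Y - W) \<le> 0\<close>, that is, \<open>Y = W\<close>.

  The nuclear norm and soft thresholding are definite descriptions over all singular value
  decompositions. They denote something because decompositions exist (\<open>svd_exists\<close>), because the
  nuclear norm is dual to the operator norm (\<open>nuclear_norm_eq_sum\<close>), and because the subgradient
  inequality determines the thresholded matrix (\<open>sv_soft_threshold_eq\<close>).
\<close>

section \<open>Outer products and orthonormal families\<close>

text \<open>
  The uniqueness arguments below conclude in this way, and so does the equality case of
  Cauchy-Schwarz: they bound the squared distance of two candidates, not the distance itself.
\<close>

lemma eq_if_inner_diff_nonpos:
  fixes x y :: "'a::real_inner"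
  assumes "(x - y) \<bullet> (x - y) \<le> 0"
  shows "x = y"
  using assms by (metis inner_gt_zero_iff not_less right_minus_eq)

text \<open>
  The inner product of matrices is the entrywise one, so pairing with a rank-one matrix evaluates
  the bilinear form of \<open>G\<close>. This reduces the duality between the spectral and the nuclear norm
  to a statement about single pairs of singular vectors.
\<close>

lemma inner_outer_product:
  fixes G :: "real^'n^'m"
  shows "G \<bullet> outer_product u v = u \<bullet> (G *v v)"
  by (simp add: inner_vec_def outer_product_def matrix_vector_mult_def sum_distrib_left mult_ac)

lemma outer_product_mult_vec:
  "outer_product u v *v y = (v \<bullet> y) *\<^sub>R u"
  by (simp add: vec_eq_iff inner_vec_def outer_product_def matrix_vector_mult_def
      sum_distrib_left sum_distrib_right mult_ac)

lemma outer_sum_mult_vec: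
  fixes r :: nat
  shows "(\<Sum>k<r. c k *\<^sub>R outer_product (U k) (V k)) *v y = (\<Sum>k<r. (c k * (V k \<bullet> y)) *\<^sub>R U k)"
  by (induction r) (simp_all add: matrix_vector_mult_add_rdistrib
      scaleR_matrix_vector_assoc [symmetric] outer_product_mult_vec)

lemma transpose_outer_sum:
  "transpose (\<Sum>k<r. c k *\<^sub>R outer_product (U k) (V k)) = (\<Sum>k<r. c k *\<^sub>R outer_product (V k) (U k))"
  by (simp add: vec_eq_iff transpose_def outer_product_def mult_ac)

lemma orthonormal_sum_inner:
  assumes "orthonormal_family r U" "l < r"
  shows "(\<Sum>k<r. c k *\<^sub>R U k) \<bullet> U l = c l"
proof -
  have "(\<Sum>k<r. c k *\<^sub>R U k) \<bullet> U l = (\<Sum>k<r. if k = l then c k else 0)"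
    unfolding inner_sum_left using assms by (intro sum.cong) (auto simp: orthonormal_family_def)
  then show ?thesis using assms by simp
qed

lemma outer_sum_mult_singular_vector:
  assumes "orthonormal_family r V" "l < r"
  shows "(\<Sum>k<r. c k *\<^sub>R outer_product (U k) (V k)) *v V l = c l *\<^sub>R U l"
proof -
  have "(\<Sum>k<r. (c k * (V k \<bullet> V l)) *\<^sub>R U k) = (\<Sum>k<r. if k = l then c k *\<^sub>R U k else 0)"
    using assms by (intro sum.cong) (auto simp: orthonormal_family_def)
  then show ?thesis using assms by (simp add: outer_sum_mult_vec)
qed

lemma outer_sum_inner:
  assumes "orthonormal_family r U" "orthonormal_family r V"
  shows "(\<Sum>k<r. c k *\<^sub>R outer_product (U k) (V k)) \<bullet> (\<Sum>k<r. d k *\<^sub>R outer_product (U k) (V k))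
    = (\<Sum>k<r. c k * d k)"
proof -
  have "(\<Sum>k<r. c k *\<^sub>R outer_product (U k) (V k)) \<bullet> (d l *\<^sub>R outer_product (U l) (V l)) = c l * d l"
    if "l < r" for l
    using assms that by (simp add: inner_outer_product outer_sum_mult_singular_vector)
      (simp add: orthonormal_family_def)
  then show ?thesis unfolding inner_sum_right by (intro sum.cong) auto
qed

text \<open>
  The squared distance of \<open>x\<close> from its projection \<open>p\<close> to the span of the family is
  nonnegative, and it equals the difference of the two sides.
\<close>

lemma bessel_inequality:
  fixes u :: "nat \<Rightarrow> real^'n"
  assumes "orthonormal_family r u"
  shows "(\<Sum>k<r. (u k \<bullet> x)\<^sup>2) \<le> (norm x)\<^sup>2"
proof -
  define p where "p = (\<Sum>k<r. (u k \<bullet> x) *\<^sub>R u k)"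
  have px: "p \<bullet> x = (\<Sum>k<r. (u k \<bullet> x)\<^sup>2)"
    by (simp add: p_def inner_sum_left power2_eq_square)
  have "p \<bullet> p = (\<Sum>k<r. (u k \<bullet> x) * (p \<bullet> u k))"
    by (subst (2) p_def) (simp add: inner_sum_right)
  also have "\<dots> = (\<Sum>k<r. (u k \<bullet> x)\<^sup>2)"
    by (intro sum.cong) (simp_all add: p_def orthonormal_sum_inner [OF assms] power2_eq_square)
  finally have "p \<bullet> p = (\<Sum>k<r. (u k \<bullet> x)\<^sup>2)" .
  moreover have "0 \<le> (x - p) \<bullet> (x - p)" by simp
  ultimately show ?thesis
    using px by (simp add: inner_diff inner_commute power2_norm_eq_inner)
qed

section \<open>Duality of the spectral and the nuclear norm\<close>

text \<open>
  This bounds the operator norm by \<open>\<tau>\<close>. It is phrased through the bilinear form because the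
  latter is what pairing with a rank-one matrix produces.
\<close>

definition spectral_bound :: "real \<Rightarrow> real^'n^'m \<Rightarrow> bool" where
  "spectral_bound \<tau> G \<longleftrightarrow> (\<forall>x y. x \<bullet> (G *v y) \<le> \<tau> * norm x * norm y)"

text \<open>
  In the two orthonormal families the bilinear form is diagonal; Cauchy-Schwarz for the
  coordinates followed by Bessel's inequality for each family gives the bound.
\<close>

lemma spectral_bound_outer_sum:
  assumes U: "orthonormal_family r U" and V: "orthonormal_family r V"
    and c: "\<And>k. k < r \<Longrightarrow> \<bar>c k\<bar> \<le> \<tau>" and "0 \<le> \<tau>"
  shows "spectral_bound \<tau> (\<Sum>k<r. c k *\<^sub>R outer_product (U k) (V k))"
  unfolding spectral_bound_def
proof (intro allI)
  fix x y
  have "x \<bullet> ((\<Sum>k<r. c k *\<^sub>R outer_product (U k) (V k)) *v y)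
      = (\<Sum>k<r. c k * (V k \<bullet> y) * (U k \<bullet> x))"
    by (simp add: outer_sum_mult_vec inner_sum_right inner_commute)
  also have "\<dots> \<le> (\<Sum>k<r. \<tau> * (\<bar>V k \<bullet> y\<bar> * \<bar>U k \<bullet> x\<bar>))"
  proof (intro sum_mono)
    fix k assume "k \<in> {..<r}"
    have "c k * (V k \<bullet> y) * (U k \<bullet> x) \<le> \<bar>c k\<bar> * (\<bar>V k \<bullet> y\<bar> * \<bar>U k \<bullet> x\<bar>)"
      by (metis abs_ge_self abs_mult mult.assoc)
    also have "\<dots> \<le> \<tau> * (\<bar>V k \<bullet> y\<bar> * \<bar>U k \<bullet> x\<bar>)"
      using c \<open>k \<in> {..<r}\<close> by (intro mult_right_mono) auto
    finally show "c k * (V k \<bullet> y) * (U k \<bullet> x) \<le> \<tau> * (\<bar>V k \<bullet> y\<bar> * \<bar>U k \<bullet> x\<bar>)" .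
  qed
  also have "\<dots> = \<tau> * (\<Sum>k<r. \<bar>V k \<bullet> y\<bar> * \<bar>U k \<bullet> x\<bar>)"
    by (simp add: sum_distrib_left)
  also have "\<dots> \<le> \<tau> * (norm y * norm x)"
  proof (intro mult_left_mono \<open>0 \<le> \<tau>\<close>)
    have "(\<Sum>k<r. \<bar>V k \<bullet> y\<bar> * \<bar>U k \<bullet> x\<bar>)
        \<le> L2_set (\<lambda>k. V k \<bullet> y) {..<r} * L2_set (\<lambda>k. U k \<bullet> x) {..<r}"
      by (rule L2_set_mult_ineq)
    also have "\<dots> \<le> norm y * norm x"
      using bessel_inequality [OF U] bessel_inequality [OF V]
      by (intro mult_mono) (auto simp: L2_set_def intro: real_le_lsqrt sum_nonneg)
    finally show "(\<Sum>k<r. \<bar>V k \<bullet> y\<bar> * \<bar>U k \<bullet> x\<bar>) \<le> norm y * norm x" .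
  qed
  finally show "x \<bullet> ((\<Sum>k<r. c k *\<^sub>R outer_product (U k) (V k)) *v y) \<le> \<tau> * norm x * norm y"
    by (simp add: mult_ac)
qed

text \<open>
  One half of the duality between nuclear and spectral norm: every singular pair consists of unit
  vectors, so it contributes at most \<open>\<tau>\<close> times its singular value.
\<close>

lemma inner_le_sum_singular_values:
  assumes "is_svd X r U \<sigma> V" "spectral_bound \<tau> G"
  shows "G \<bullet> X \<le> \<tau> * (\<Sum>k<r. \<sigma> k)"
proof -
  have "G \<bullet> X = (\<Sum>k<r. \<sigma> k * (U k \<bullet> (G *v V k)))"
    using assms(1) by (simp add: is_svd_def inner_sum_right inner_outer_product)
  also have "\<dots> \<le> (\<Sum>k<r. \<sigma> k * \<tau>)"
  proof (intro sum_mono mult_left_mono)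
    fix k assume "k \<in> {..<r}"
    then have "norm (U k) = 1" "norm (V k) = 1" "0 \<le> \<sigma> k"
      using assms(1) by (auto simp: is_svd_def orthonormal_family_def norm_eq_1)
    moreover from this have "U k \<bullet> (G *v V k) \<le> \<tau>"
      using assms(2) unfolding spectral_bound_def by (metis mult.right_neutral)
    ultimately show "U k \<bullet> (G *v V k) \<le> \<tau>" "0 \<le> \<sigma> k" by simp_all
  qed
  finally show ?thesis by (simp add: sum_distrib_left mult.commute)
qed

text \<open>
  The other half of the duality: the bound for \<open>\<tau> = 1\<close> is attained at the matrix obtained by
  replacing all singular values by 1.
\<close>

lemma dual_certificate:
  assumes "is_svd X r U \<sigma> V"
  obtains G where "spectral_bound 1 G" "G \<bullet> X = (\<Sum>k<r. \<sigma> k)"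
proof
  let ?G = "\<Sum>k<r. 1 *\<^sub>R outer_product (U k) (V k)"
  have on: "orthonormal_family r U" "orthonormal_family r V"
    and X: "X = (\<Sum>k<r. \<sigma> k *\<^sub>R outer_product (U k) (V k))"
    using assms by (auto simp: is_svd_def)
  show "spectral_bound 1 ?G" using on by (intro spectral_bound_outer_sum) auto
  show "?G \<bullet> X = (\<Sum>k<r. \<sigma> k)"
    using outer_sum_inner [OF on, of "\<lambda>_. 1" \<sigma>] X by simp
qed

text \<open>
  The certificate of either decomposition is bounded by the sum of the singular values of the
  other one, so the two sums agree and the nuclear norm is well defined.
\<close>

lemma nuclear_norm_eq_sum:
  assumes "is_svd X r U \<sigma> V"
  shows "nuclear_norm X = (\<Sum>k<r. \<sigma> k)"
  unfolding nuclear_norm_def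
proof (rule the_equality)
  show "\<exists>r' U' \<sigma>' V'. is_svd X r' U' \<sigma>' V' \<and> (\<Sum>k<r. \<sigma> k) = (\<Sum>k<r'. \<sigma>' k)"
    using assms by blast
next
  fix s assume "\<exists>r' U' \<sigma>' V'. is_svd X r' U' \<sigma>' V' \<and> s = (\<Sum>k<r'. \<sigma>' k)"
  then obtain r' U' \<sigma>' V' where svd': "is_svd X r' U' \<sigma>' V'" and s: "s = (\<Sum>k<r'. \<sigma>' k)"
    by blast
  obtain G where "spectral_bound 1 G" "G \<bullet> X = (\<Sum>k<r. \<sigma> k)"
    using dual_certificate [OF assms] .
  moreover obtain G' where "spectral_bound 1 G'" "G' \<bullet> X = (\<Sum>k<r'. \<sigma>' k)"
    using dual_certificate [OF svd'] .
  ultimately show "s = (\<Sum>k<r. \<sigma> k)"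
    using inner_le_sum_singular_values [OF assms] inner_le_sum_singular_values [OF svd'] s
    by (metis mult_1 order_antisym)
qed

section \<open>Existence of singular value decompositions\<close>

text \<open>
  The bilinear form of \<open>A\<close> attains its maximum \<open>s\<close> over the product of the unit balls, and
  the equality case of Cauchy-Schwarz turns a maximizer into a singular pair.
\<close>

lemma top_singular_pair:
  fixes A :: "real^'n^'m"
  assumes "A \<noteq> 0"
  obtains s u v where "0 < s" "norm u = 1" "norm v = 1"
    "A *v v = s *\<^sub>R u" "transpose A *v u = s *\<^sub>R v"
proof -
  let ?K = "cball (0 :: real^'m) 1 \<times> cball (0 :: real^'n) 1"
  have "compact ?K" by (intro compact_Times compact_cball)
  moreover have "?K \<noteq> {}" by simp
  moreover have "continuous_on ?K (\<lambda>p. fst p \<bullet> (A *v snd p))"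
    by (intro continuous_intros matrix_vector_mult_linear_continuous_on
        continuous_on_compose2 [of UNIV "(*v) A" _ snd]) auto
  ultimately have "\<exists>p\<in>?K. \<forall>q\<in>?K. fst q \<bullet> (A *v snd q) \<le> fst p \<bullet> (A *v snd p)"
    by (rule continuous_attains_sup)
  then obtain p where p: "p \<in> ?K"
    and max: "\<And>q. q \<in> ?K \<Longrightarrow> fst q \<bullet> (A *v snd q) \<le> fst p \<bullet> (A *v snd p)"
    by metis
  define u v s where "u = fst p" and "v = snd p" and "s = u \<bullet> (A *v v)"
  have uv: "norm u \<le> 1" "norm v \<le> 1"
    using p by (auto simp: u_def v_def)
  \<comment> \<open>By homogeneity, the maximum over the balls bounds the form everywhere.\<close>
  have bound: "x \<bullet> (A *v y) \<le> s * norm x * norm y" for x y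
  proof (cases "x = 0 \<or> y = 0")
    case False
    have "sgn x \<bullet> (A *v sgn y) \<le> s"
      using max [of "(sgn x, sgn y)"] by (simp add: s_def u_def v_def norm_sgn)
    moreover have "x \<bullet> (A *v y) = norm x * norm y * (sgn x \<bullet> (A *v sgn y))"
      using False by (simp add: sgn_div_norm matrix_vector_mult_scaleR field_simps)
    ultimately show ?thesis
      using mult_left_mono [of "sgn x \<bullet> (A *v sgn y)" s "norm x * norm y"]
      by (simp add: mult_ac)
  qed (elim disjE, simp_all)
  have s0: "0 \<le> s" using max [of "(0, 0)"] by (simp add: s_def u_def v_def)
  have "s \<noteq> 0"
  proof
    assume "s = 0"
    then have "(A *v y) \<bullet> (A *v y) \<le> 0" for y using bound [of "A *v y" y] by simp
    then have "A *v y = 0" for y by (metis inner_gt_zero_iff not_less)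
    then show False using assms by (simp add: matrix_eq)
  qed
  with s0 have s: "0 < s" by simp
  \<comment> \<open>The equality case of Cauchy-Schwarz: \<open>w\<close> has norm at most \<open>s\<close>, but its inner product with
    \<open>x\<close>, of norm at most 1, is \<open>s\<close>. It is used for \<open>A *v v\<close> and for \<open>transpose A *v u\<close>.\<close>
  have *: "w = s *\<^sub>R x"
    if w: "w \<bullet> w \<le> s * norm w" and wx: "w \<bullet> x = s" and x: "norm x \<le> 1"
    for w x :: "real^'k"
  proof -
    have "norm w * norm w \<le> s * norm w" using w by (simp add: norm_eq_sqrt_inner)
    then have "norm w \<le> s" using s by (metis mult_right_le_imp_le norm_ge_zero less_eq_real_def)
    then have "w \<bullet> w \<le> s * s"
      by (metis mult_mono norm_ge_zero power2_eq_square power2_norm_eq_inner s0)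
    moreover have "x \<bullet> x \<le> 1" using x by (simp add: norm_le_square)
    then have "s * s * (x \<bullet> x) \<le> s * s" by (simp add: mult_left_le)
    moreover have "(w - s *\<^sub>R x) \<bullet> (w - s *\<^sub>R x) = w \<bullet> w - 2 * s * (w \<bullet> x) + s * s * (x \<bullet> x)"
      by (simp add: algebra_simps inner_commute)
    ultimately have "(w - s *\<^sub>R x) \<bullet> (w - s *\<^sub>R x) \<le> 0" using wx by simp
    then show ?thesis by (rule eq_if_inner_diff_nonpos)
  qed
  have adj: "(transpose A *v x) \<bullet> y = x \<bullet> (A *v y)" for x y
    by (simp add: dot_lmul_matrix)
  have Av: "A *v v = s *\<^sub>R u"
  proof (rule *)
    have "(A *v v) \<bullet> (A *v v) \<le> s * norm (A *v v) * norm v" by (rule bound)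
    also have "\<dots> \<le> s * norm (A *v v)" using uv s0 by (simp add: mult_left_le)
    finally show "(A *v v) \<bullet> (A *v v) \<le> s * norm (A *v v)" .
  qed (use uv in \<open>auto simp: s_def inner_commute\<close>)
  have Au: "transpose A *v u = s *\<^sub>R v"
  proof (rule *)
    let ?w = "transpose A *v u"
    have "?w \<bullet> ?w \<le> s * norm u * norm ?w" using bound [of u ?w] unfolding adj [symmetric] .
    also have "\<dots> \<le> s * norm ?w"
      using uv s0 by (intro mult_right_mono) (auto simp: mult_left_le)
    finally show "?w \<bullet> ?w \<le> s * norm ?w" .
  qed (use uv in \<open>simp_all only: s_def adj\<close>)
  have "s = s * (u \<bullet> u)" using Av by (metis s_def inner_scaleR_right)
  then have "norm u = 1" using s by (simp add: norm_eq_1)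
  moreover have "s = s * (v \<bullet> v)" using Au adj by (metis s_def inner_scaleR_left)
  then have "norm v = 1" using s by (simp add: norm_eq_1)
  ultimately show thesis by (intro that [OF s _ _ Av Au])
qed

text \<open>
  This bounds the length of a family of singular pairs, so that a longest one exists.
\<close>

lemma orthonormal_family_le_card:
  fixes u :: "nat \<Rightarrow> real^'n"
  assumes "orthonormal_family r u"
  shows "r \<le> CARD('n)"
proof -
  have inj: "inj_on u {..<r}"
    using assms by (intro inj_onI) (metis lessThan_iff orthonormal_family_def zero_neq_one)
  have "pairwise orthogonal (u ` {..<r})"
    using assms by (auto simp: pairwise_def orthogonal_def orthonormal_family_def)
  moreover have "0 \<notin> u ` {..<r}"
    using assms by (auto simp: orthonormal_family_def) (metis inner_zero_left zero_neq_one)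
  ultimately have "independent (u ` {..<r})" by (rule pairwise_orthogonal_independent)
  then have "card (u ` {..<r}) \<le> DIM(real^'n)" using independent_bound by blast
  then show ?thesis using inj by (simp add: card_image)
qed

text \<open>
  A longest family of singular pairs exhausts \<open>A\<close>: a top singular pair of a nonzero
  remainder \<open>A - S\<close> would be orthogonal to the family, hence also singular for \<open>A\<close>, and
  would extend the family.
\<close>

lemma svd_exists:
  fixes A :: "real^'n^'m"
  obtains r U \<sigma> V where "is_svd A r U \<sigma> V"
proof -
  let ?P = "\<lambda>r. \<exists>U V \<sigma>. orthonormal_family r U \<and> orthonormal_family r V \<and>
    (\<forall>k<r. 0 < \<sigma> k \<and> A *v V k = \<sigma> k *\<^sub>R U k \<and> transpose A *v U k = \<sigma> k *\<^sub>R V k)"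
  have "?P 0" by (simp add: orthonormal_family_def)
  moreover have "\<forall>r. ?P r \<longrightarrow> r \<le> CARD('n)" using orthonormal_family_le_card by blast
  ultimately obtain r where r: "?P r" and rmax: "\<And>r'. ?P r' \<Longrightarrow> r' \<le> r"
    using Nat.ex_has_greatest_nat [of ?P 0 "CARD('n)"] by blast
  then obtain U V \<sigma> where U: "orthonormal_family r U" and V: "orthonormal_family r V"
    and pos: "\<And>k. k < r \<Longrightarrow> 0 < \<sigma> k"
    and AV: "\<And>k. k < r \<Longrightarrow> A *v V k = \<sigma> k *\<^sub>R U k"
    and AU: "\<And>k. k < r \<Longrightarrow> transpose A *v U k = \<sigma> k *\<^sub>R V k"
    by blast
  define S where "S = (\<Sum>k<r. \<sigma> k *\<^sub>R outer_product (U k) (V k))"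
  have S_T: "transpose S = (\<Sum>k<r. \<sigma> k *\<^sub>R outer_product (V k) (U k))"
    by (simp add: S_def transpose_outer_sum)
  have RV: "(A - S) *v V k = 0" if "k < r" for k
    using that AV by (simp add: matrix_vector_mult_diff_rdistrib S_def
        outer_sum_mult_singular_vector [OF V])
  have T_diff: "transpose (A - S) = transpose A - transpose S"
    by (simp add: vec_eq_iff transpose_def)
  have RU: "transpose (A - S) *v U k = 0" if "k < r" for k
    using that AU by (simp add: T_diff matrix_vector_mult_diff_rdistrib S_T
        outer_sum_mult_singular_vector [OF U])
  have "A - S = 0"
  proof (rule ccontr)
    assume "A - S \<noteq> 0"
    then obtain s u v where s: "0 < s" and n: "norm u = 1" "norm v = 1"
      and Rv: "(A - S) *v v = s *\<^sub>R u" and Ru: "transpose (A - S) *v u = s *\<^sub>R v"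
      by (rule top_singular_pair)
    have adj: "(transpose (A - S) *v x) \<bullet> y = x \<bullet> ((A - S) *v y)" for x y
      by (simp add: dot_lmul_matrix)
    \<comment> \<open>The family lies in the kernels of the remainder and of its transpose, and these are
      orthogonal to the new singular vectors.\<close>
    have uU: "U k \<bullet> u = 0" if "k < r" for k
      using adj [of "U k" v] s unfolding RU [OF that] Rv by simp
    have vV: "V k \<bullet> v = 0" if "k < r" for k
      using adj [of u "V k"] s unfolding RV [OF that] Ru by (simp add: inner_commute)
    have "S *v v = 0" "transpose S *v u = 0"
      unfolding S_T unfolding S_def outer_sum_mult_vec by (simp_all add: uU vV)
    then have "A *v v = s *\<^sub>R u" "transpose A *v u = s *\<^sub>R v"
      using Rv Ru by (simp_all add: T_diff matrix_vector_mult_diff_rdistrib)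
    moreover have "orthonormal_family (Suc r) (U(r := u))" "orthonormal_family (Suc r) (V(r := v))"
      using U V uU vV n
      by (auto simp: orthonormal_family_def less_Suc_eq inner_commute norm_eq_1)
    ultimately have "?P (Suc r)"
      using AV AU pos s
      by (intro exI [of _ "U(r := u)"] exI [of _ "V(r := v)"] exI [of _ "\<sigma>(r := s)"])
        (auto simp: less_Suc_eq)
    then show False using rmax by fastforce
  qed
  then have "is_svd A r U \<sigma> V"
    using U V pos by (auto simp: is_svd_def S_def less_imp_le)
  then show thesis by (rule that)
qed

section \<open>Convexity of the nuclear norm\<close>

lemma nuclear_norm_duality:
  assumes "spectral_bound \<tau> G"
  shows "G \<bullet> X \<le> \<tau> * nuclear_norm X"
  by (metis assms inner_le_sum_singular_values nuclear_norm_eq_sum svd_exists)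

lemma nuclear_norm_nonneg: "0 \<le> nuclear_norm X"
proof -
  obtain r U \<sigma> V where svd: "is_svd X r U \<sigma> V" by (rule svd_exists)
  then have "0 \<le> (\<Sum>k<r. \<sigma> k)" by (auto simp: is_svd_def intro: sum_nonneg)
  then show ?thesis by (simp add: nuclear_norm_eq_sum [OF svd])
qed

text \<open>
  As a maximum of the linear functionals given by matrices of operator norm at most 1, the nuclear
  norm is sublinear; the certificate of the left-hand side bounds both terms on the right.
\<close>

lemma nuclear_norm_convex_combination:
  assumes "0 \<le> s" "0 \<le> t"
  shows "nuclear_norm (s *\<^sub>R X + t *\<^sub>R Y) \<le> s * nuclear_norm X + t * nuclear_norm Y"
proof -
  obtain r U \<sigma> V where svd: "is_svd (s *\<^sub>R X + t *\<^sub>R Y) r U \<sigma> V" by (rule svd_exists)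
  obtain G where G: "spectral_bound 1 G" "G \<bullet> (s *\<^sub>R X + t *\<^sub>R Y) = (\<Sum>k<r. \<sigma> k)"
    using dual_certificate [OF svd] .
  have "nuclear_norm (s *\<^sub>R X + t *\<^sub>R Y) = s * (G \<bullet> X) + t * (G \<bullet> Y)"
    using G by (simp add: nuclear_norm_eq_sum [OF svd] inner_add_right)
  also have "\<dots> \<le> s * nuclear_norm X + t * nuclear_norm Y"
    using nuclear_norm_duality [OF G(1)] assms by (intro add_mono mult_left_mono) auto
  finally show ?thesis .
qed

section \<open>Soft thresholding of singular values\<close>

text \<open>
  This is the optimality condition of \<open>W\<close> for the proximal problem of \<open>\<tau>\<close> times the nuclear
  norm at \<open>Z\<close>: the residual \<open>Z - W\<close> is a subgradient of that function at \<open>W\<close>. Thresholding truncates the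
  singular values of the residual at \<open>\<tau>\<close>, which bounds its operator norm, and they equal
  \<open>\<tau>\<close> wherever those of \<open>W\<close> are positive, which gives equality in the duality at \<open>W\<close>.
\<close>

lemma soft_threshold_subgradient:
  assumes svd: "is_svd Z r U \<sigma> V" and \<tau>: "0 \<le> \<tau>"
    and W: "W = (\<Sum>k<r. max (\<sigma> k - \<tau>) 0 *\<^sub>R outer_product (U k) (V k))"
  shows "(Z - W) \<bullet> (X - W) \<le> \<tau> * (nuclear_norm X - nuclear_norm W)"
proof -
  have on: "orthonormal_family r U" "orthonormal_family r V" and nn: "\<And>k. k < r \<Longrightarrow> 0 \<le> \<sigma> k"
    and Z: "Z = (\<Sum>k<r. \<sigma> k *\<^sub>R outer_product (U k) (V k))"
    using svd by (auto simp: is_svd_def)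
  have G: "Z - W = (\<Sum>k<r. min (\<sigma> k) \<tau> *\<^sub>R outer_product (U k) (V k))"
    unfolding Z W sum_subtractf [symmetric] scaleR_left_diff_distrib [symmetric]
    by (intro sum.cong arg_cong2 [where f = scaleR]) auto
  have "spectral_bound \<tau> (Z - W)"
    unfolding G using on nn \<tau> by (intro spectral_bound_outer_sum) auto
  then have "(Z - W) \<bullet> X \<le> \<tau> * nuclear_norm X" by (rule nuclear_norm_duality)
  moreover have "is_svd W r U (\<lambda>k. max (\<sigma> k - \<tau>) 0) V"
    using on W by (simp add: is_svd_def)
  then have "nuclear_norm W = (\<Sum>k<r. max (\<sigma> k - \<tau>) 0)" by (rule nuclear_norm_eq_sum)
  moreover have "(Z - W) \<bullet> W = (\<Sum>k<r. min (\<sigma> k) \<tau> * max (\<sigma> k - \<tau>) 0)"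
    unfolding G unfolding W by (rule outer_sum_inner [OF on])
  moreover have "\<dots> = (\<Sum>k<r. \<tau> * max (\<sigma> k - \<tau>) 0)"
    by (intro sum.cong) auto
  ultimately show ?thesis by (simp add: inner_diff_right right_diff_distrib sum_distrib_left)
qed

text \<open>
  The subgradient inequality characterizes the result of thresholding: if it holds for two
  matrices, inserting each into the inequality of the other and adding makes the nuclear norms
  cancel and leaves the squared distance.
\<close>

lemma sv_soft_threshold_eq:
  assumes svd: "is_svd Z r U \<sigma> V" and \<tau>: "0 \<le> \<tau>"
  shows "sv_soft_threshold \<tau> Z = (\<Sum>k<r. max (\<sigma> k - \<tau>) 0 *\<^sub>R outer_product (U k) (V k))"
    (is "_ = ?W")
  unfolding sv_soft_threshold_def
proof (rule the_equality)
  show "\<exists>r' U' \<sigma>' V'. is_svd Z r' U' \<sigma>' V' \<and>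
      ?W = (\<Sum>k<r'. max (\<sigma>' k - \<tau>) 0 *\<^sub>R outer_product (U' k) (V' k))"
    using svd by blast
next
  fix W assume "\<exists>r' U' \<sigma>' V'. is_svd Z r' U' \<sigma>' V' \<and>
      W = (\<Sum>k<r'. max (\<sigma>' k - \<tau>) 0 *\<^sub>R outer_product (U' k) (V' k))"
  then have "(Z - W) \<bullet> (?W - W) \<le> \<tau> * (nuclear_norm ?W - nuclear_norm W)"
    using soft_threshold_subgradient [OF _ \<tau>] by blast
  moreover have "(Z - ?W) \<bullet> (W - ?W) \<le> \<tau> * (nuclear_norm W - nuclear_norm ?W)"
    by (rule soft_threshold_subgradient [OF svd \<tau> refl])
  ultimately have "(?W - W) \<bullet> (?W - W) \<le> 0"
    by (simp add: algebra_simps inner_commute)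
  then show "W = ?W" by (rule eq_if_inner_diff_nonpos [symmetric])
qed

text \<open>
  Thresholding keeps the constraint: a vector in the kernel of \<open>Z\<close> is orthogonal to every right
  singular vector with a positive singular value, and only those survive.
\<close>

lemma mult_vec_soft_threshold_eq_0:
  assumes svd: "is_svd Z r U \<sigma> V" and \<tau>: "0 \<le> \<tau>" and Zy: "Z *v y = 0"
  shows "(\<Sum>k<r. max (\<sigma> k - \<tau>) 0 *\<^sub>R outer_product (U k) (V k)) *v y = 0"
proof -
  have "\<sigma> k * (V k \<bullet> y) = 0" if "k < r" for k
    using svd that Zy orthonormal_sum_inner [of r U k "\<lambda>k. \<sigma> k * (V k \<bullet> y)"]
    by (auto simp: is_svd_def outer_sum_mult_vec simp del: mult_eq_0_iff)
  then have "max (\<sigma> k - \<tau>) 0 * (V k \<bullet> y) = 0" if "k < r" for k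
    using that \<tau> by fastforce
  then show ?thesis unfolding outer_sum_mult_vec by (intro sum.neutral) simp
qed

section \<open>The linear constraint\<close>

lemma matrix_mult_eq_0_iff:
  fixes X :: "real^'n^'m"
  shows "X ** B = 0 \<longleftrightarrow> (\<forall>b. X *v (B *v b) = 0)"
  by (simp add: matrix_eq matrix_vector_mul_assoc)

lemma perp_projection_mult:
  assumes "orthonormal_columns B"
  shows "perp_projection B ** B = 0"
proof -
  have "transpose B ** B = mat 1"
    using assms by (simp add: orthonormal_columns_def vec_eq_iff matrix_matrix_mult_def
        transpose_def mat_def column_def inner_vec_def)
  then have "transpose B *v (B *v b) = b" for b by (simp add: matrix_vector_mul_assoc)
  then show ?thesis
    by (simp add: matrix_mult_eq_0_iff perp_projection_def matrix_vector_mult_diff_rdistrib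
        matrix_vector_mul_assoc [symmetric] del: transpose_matrix_vector)
qed

text \<open>
  On the constraint subspace \<open>M\<close> acts through its projection only, since right
  multiplication by the symmetric matrix \<open>perp_projection B\<close> fixes \<open>X\<close>.
\<close>

lemma inner_perp_projection:
  fixes X M :: "real^'n^'m"
  assumes "X ** B = 0"
  shows "(M ** perp_projection B) \<bullet> X = M \<bullet> X"
proof -
  have adj: "(M ** P) \<bullet> X = M \<bullet> (X ** transpose P)" for P :: "real^'n^'n"
    unfolding inner_vec_def matrix_matrix_mult_def transpose_def
    by (simp add: sum_distrib_left sum_distrib_right mult_ac)
      (rule sum.cong [OF refl], rule sum.swap)
  have T: "transpose (perp_projection B) = perp_projection B"
    by (simp add: perp_projection_def vec_eq_iff transpose_def mat_def matrix_matrix_mult_def mult_ac)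
  have "X ** perp_projection B = X"
    using assms unfolding matrix_mult_eq_0_iff
    by (simp add: matrix_eq perp_projection_def matrix_vector_mult_diff_rdistrib
        matrix_vector_mult_diff_distrib matrix_vector_mul_assoc [symmetric]
        del: transpose_matrix_vector)
  then show ?thesis by (simp add: adj T)
qed

section \<open>The variational inequality of the minimizer\<close>

lemma nonneg_if_linear_dominates:
  fixes p q :: real
  assumes "\<And>t. 0 < t \<Longrightarrow> t \<le> 1 \<Longrightarrow> 0 \<le> t * p + t\<^sup>2 * q"
  shows "0 \<le> p"
proof (rule tendsto_lowerbound)
  show "((\<lambda>t. p + t * q) \<longlongrightarrow> p) (at_right 0)"
    by (auto intro!: tendsto_eq_intros)
  show "\<forall>\<^sub>F t in at_right 0. 0 \<le> p + t * q"
    unfolding eventually_at_right_field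
  proof (intro exI [of _ 1] conjI allI impI)
    fix t :: real assume "0 < t" "t < 1"
    then have "0 \<le> t * (p + t * q)"
      using assms [of t] by (simp add: algebra_simps power2_eq_square)
    then show "0 \<le> p + t * q" using \<open>0 < t\<close> by (simp add: zero_le_mult_iff)
  qed simp
qed simp

text \<open>
  The nuclear norm is not differentiable, but along the segment from \<open>Y\<close> to \<open>W\<close> it lies below
  its linear interpolation. Replacing it by the latter preserves the value at \<open>Y\<close>, so the
  parameter 0 minimizes the resulting quadratic polynomial over the unit interval, and the
  derivative there, which is the right-hand side, is nonnegative.
\<close>

lemma minimizer_first_order_condition:
  fixes Y W M :: "real^'n^'m"
  assumes min: "\<And>t. 0 < t \<Longrightarrow> t \<le> 1 \<Longrightarrow>
      (nuclear_norm Y)\<^sup>2 + a / 2 * (norm Y)\<^sup>2 + \<eta> / 2 * (norm (Y - M))\<^sup>2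
      \<le> (nuclear_norm (Y + t *\<^sub>R (W - Y)))\<^sup>2 + a / 2 * (norm (Y + t *\<^sub>R (W - Y)))\<^sup>2
        + \<eta> / 2 * (norm (Y + t *\<^sub>R (W - Y) - M))\<^sup>2"
  shows "0 \<le> 2 * nuclear_norm Y * (nuclear_norm W - nuclear_norm Y)
    + (a + \<eta>) * (Y \<bullet> (W - Y)) - \<eta> * (M \<bullet> (W - Y))"
proof -
  define D where "D = W - Y"
  define y \<delta> where "y = nuclear_norm Y" and "\<delta> = nuclear_norm W - nuclear_norm Y"
  have sq: "(norm (Q + t *\<^sub>R D))\<^sup>2 = (norm Q)\<^sup>2 + 2 * t * (Q \<bullet> D) + t\<^sup>2 * (norm D)\<^sup>2"
    for Q :: "real^'n^'m" and t
    unfolding power2_norm_eq_inner by (simp add: algebra_simps inner_commute power2_eq_square)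
  have "0 \<le> 2 * y * \<delta> + a * (Y \<bullet> D) + \<eta> * ((Y - M) \<bullet> D)"
  proof (rule nonneg_if_linear_dominates)
    fix t :: real assume t: "0 < t" "t \<le> 1"
    have "Y + t *\<^sub>R D = (1 - t) *\<^sub>R Y + t *\<^sub>R W" by (simp add: D_def algebra_simps)
    then have "nuclear_norm (Y + t *\<^sub>R D) \<le> (1 - t) * nuclear_norm Y + t * nuclear_norm W"
      using nuclear_norm_convex_combination [of "1 - t" t Y W] t by simp
    then have "nuclear_norm (Y + t *\<^sub>R D) \<le> y + t * \<delta>"
      by (simp add: y_def \<delta>_def algebra_simps)
    then have "(nuclear_norm (Y + t *\<^sub>R D))\<^sup>2 \<le> (y + t * \<delta>)\<^sup>2"
      by (intro power_mono nuclear_norm_nonneg)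
    moreover have "Y + t *\<^sub>R D - M = (Y - M) + t *\<^sub>R D" by simp
    ultimately have "y\<^sup>2 + a / 2 * (norm Y)\<^sup>2 + \<eta> / 2 * (norm (Y - M))\<^sup>2
        \<le> (y + t * \<delta>)\<^sup>2 + a / 2 * ((norm Y)\<^sup>2 + 2 * t * (Y \<bullet> D) + t\<^sup>2 * (norm D)\<^sup>2)
          + \<eta> / 2 * ((norm (Y - M))\<^sup>2 + 2 * t * ((Y - M) \<bullet> D) + t\<^sup>2 * (norm D)\<^sup>2)"
      using min [OF t] unfolding D_def [symmetric] y_def [symmetric] by (simp only: sq)
    then show "0 \<le> t * (2 * y * \<delta> + a * (Y \<bullet> D) + \<eta> * ((Y - M) \<bullet> D))
        + t\<^sup>2 * (\<delta>\<^sup>2 + a / 2 * (norm D)\<^sup>2 + \<eta> / 2 * (norm D)\<^sup>2)"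
      by (simp add: power2_sum power_mult_distrib distrib_left distrib_right mult_ac)
  qed
  then show ?thesis
    by (simp add: y_def \<delta>_def D_def [symmetric] algebra_simps)
qed

section \<open>The implicit equation\<close>

theorem theorem1:
  fixes B :: "real^3^'v" and M Y :: "real^'v^'x" and a\<^sub>2 \<eta> :: real
    and g :: "real^'v^'x \<Rightarrow> ereal"
    and r :: nat and U :: "nat \<Rightarrow> real^'x" and \<sigma> :: "nat \<Rightarrow> real" and V :: "nat \<Rightarrow> real^'v"
  assumes "orthonormal_columns B"
    and "a\<^sub>2 \<ge> 0" and "\<eta> > 0"
    and "\<And>X. g X = ereal ((nuclear_norm X)\<^sup>2 + a\<^sub>2 / 2 * (frobenius_norm X)\<^sup>2)
                  + convex_indicator {X. X ** B = 0} X"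
    and "is_arg_min (\<lambda>X. g X + ereal (\<eta> / 2 * (frobenius_norm (X - M))\<^sup>2)) (\<lambda>X. True) Y"
    and "is_compact_svd Y r U \<sigma> V"
  shows "Y = sv_soft_threshold (2 * nuclear_norm Y / (a\<^sub>2 + \<eta>))
               ((\<eta> / (a\<^sub>2 + \<eta>)) *\<^sub>R (M ** perp_projection B))"
proof -
  define c where "c = a\<^sub>2 + \<eta>"
  define \<tau> where "\<tau> = 2 * nuclear_norm Y / c"
  define Z where "Z = (\<eta> / c) *\<^sub>R (M ** perp_projection B)"
  define W where "W = sv_soft_threshold \<tau> Z"
  define F where "F = (\<lambda>X :: real^'v^'x. (nuclear_norm X)\<^sup>2 + a\<^sub>2 / 2 * (norm X)\<^sup>2
    + \<eta> / 2 * (norm (X - M))\<^sup>2)"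
  have c: "0 < c" using assms(2,3) by (simp add: c_def)
  then have \<tau>: "0 \<le> \<tau>" by (simp add: \<tau>_def nuclear_norm_nonneg)
  have obj: "g X + ereal (\<eta> / 2 * (frobenius_norm (X - M))\<^sup>2)
      = (if X ** B = 0 then ereal (F X) else \<infinity>)" for X
    by (simp add: assms(4) convex_indicator_def F_def frobenius_norm_eq_norm)
  have min: "(if Y ** B = 0 then ereal (F Y) else \<infinity>) \<le> (if X ** B = 0 then ereal (F X) else \<infinity>)"
    for X
    using assms(5) unfolding is_arg_min_def obj by (meson not_less)
  \<comment> \<open>The objective is finite at 0, which satisfies the constraint, so it is finite at \<open>Y\<close>.\<close>
  have YB: "Y ** B = 0"
    using min [of 0] by (simp split: if_splits)
  have min_F: "F Y \<le> F X" if "X ** B = 0" for X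
    using min [of X] YB that by simp
  obtain r' U' \<sigma>' V' where svd: "is_svd Z r' U' \<sigma>' V'" by (rule svd_exists)
  have W_eq: "W = (\<Sum>k<r'. max (\<sigma>' k - \<tau>) 0 *\<^sub>R outer_product (U' k) (V' k))"
    unfolding W_def by (rule sv_soft_threshold_eq [OF svd \<tau>])
  have "Z ** B = 0"
    using perp_projection_mult [OF assms(1)]
    by (simp add: Z_def scalar_matrix_assoc [symmetric] matrix_mul_assoc [symmetric])
  then have WB: "W ** B = 0"
    unfolding W_eq matrix_mult_eq_0_iff using mult_vec_soft_threshold_eq_0 [OF svd \<tau>] by blast
  have DB: "(W - Y) ** B = 0"
    using WB YB by (simp add: matrix_mult_eq_0_iff matrix_vector_mult_diff_rdistrib)
  have "(Y + t *\<^sub>R (W - Y)) ** B = 0" for t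
    using YB DB by (simp add: matrix_mult_eq_0_iff matrix_vector_mult_add_rdistrib
        scaleR_matrix_vector_assoc [symmetric])
  then have "0 \<le> 2 * nuclear_norm Y * (nuclear_norm W - nuclear_norm Y)
      + c * (Y \<bullet> (W - Y)) - \<eta> * (M \<bullet> (W - Y))"
    unfolding c_def using min_F
    by (intro minimizer_first_order_condition) (simp_all add: F_def)
  also have "\<eta> * (M \<bullet> (W - Y)) = c * (Z \<bullet> (W - Y))"
    using c inner_perp_projection [OF DB, of M] by (simp add: Z_def)
  also have "2 * nuclear_norm Y = c * \<tau>" using c by (simp add: \<tau>_def)
  finally have "0 \<le> c * (\<tau> * (nuclear_norm W - nuclear_norm Y) + Y \<bullet> (W - Y) - Z \<bullet> (W - Y))"
    by (simp add: algebra_simps)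
  then have "0 \<le> \<tau> * (nuclear_norm W - nuclear_norm Y) + Y \<bullet> (W - Y) - Z \<bullet> (W - Y)"
    using c by (simp add: zero_le_mult_iff)
  moreover have "(Z - W) \<bullet> (Y - W) \<le> \<tau> * (nuclear_norm Y - nuclear_norm W)"
    by (rule soft_threshold_subgradient [OF svd \<tau> W_eq])
  ultimately have "(Y - W) \<bullet> (Y - W) \<le> 0"
    by (simp add: algebra_simps inner_commute)
  then have "Y = W" by (rule eq_if_inner_diff_nonpos)
  then show ?thesis by (simp add: W_def \<tau>_def Z_def c_def)
qed

end
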